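(* Let $\mathcal{Q}$ be an $((n,M,d;c))$ EA-CWS code with CWS group $S\subset\mathcal{P}^{n+c}$ and set of word operators $W\subset\mathcal{P}^n$. Then $$d\le\min\{\mathrm{wt}(\alpha):\alpha\in\varphi(WS_I)\setminus\varphi(S_g)\},$$ where $S_I$ is the isotropic subgroup of $S$ and $S_g$ is the generalized stabilizer (GS) group of $\mathcal{Q}$.
   Context: Let $I,\sigma_x,\sigma_y,\sigma_z$ be the $2\times2$ identity and the Pauli matrices, $\mathcal{E}^m=\{\sigma_1\otimes\cdots\otimes\sigma_m:\sigma_i\in\{I,\sigma_x,\sigma_y,\sigma_z\}\}$, and $\mathcal{P}^m=\{\mathbf{i}^k\alpha: k\in\{0,1,2,3\},\alpha\in\mathcal{E}^m\}$ with $\mathbf{i}=\sqrt{-1}$. Define $\varphi:\mathcal{P}^m\to\mathcal{E}^m$ by $\varphi(\mathbf{i}^k\alpha)=\alpha$. The weight $\mathrm{wt}$ of a Pauli operator is its number of non-identity tensor factors. An operator $E\in\mathcal{E}^{n+c}$ is detectable by a subspace $\mathcal{Q}\subset\mathbb{C}^{2^{n+c}}$ if, for an orthonormal basis $\{|v_i\rangle\}$ of $\mathcal{Q}$, $\langle v_i|E|v_i\rangle=\langle v_j|E|v_j\rangle$ for all $i,j$ and $\langle v_i|E|v_j\rangle=0$ for $i\ne j$. An $((n,M,d;c))$ EA (entanglement-assisted) quantum code is an $M$-dimensional subspace $\mathcal{Q}\subset\mathbb{C}^{2^n}\otimes\mathbb{C}^{2^c}$ such that (1) for every unit vector $|v\rangle\in\mathcal{Q}$,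 $\mathrm{Tr}_{\mathbb{C}^{2^n}}(|v\rangle\langle v|)=I^{\otimes c}/2^c$; and (2) $\alpha\otimes I^{\otimes c}$ is detectable by $\mathcal{Q}$ for all $\alpha\in\mathcal{E}^n$ of weight at most $d-1$, but not for all $\alpha$ of weight $d$. A stabilizer group is an abelian subgroup of $\mathcal{P}^{n+c}$ not containing minus the identity; a CWS group is a maximal one, and $|S\rangle$ denotes the unit vector (unique up to phase) fixed by all elements of $S$. An EA quantum code $\mathcal{Q}$ is an EA-CWS code with CWS group $S\subset\mathcal{P}^{n+c}$ and word operators $W$ if $W=\{\omega_1=I^{\otimes n},\omega_2,\dots,\omega_M\}\subset\mathcal{P}^n$ is a set of $M$ pairwise commuting operators such that $\{(\omega_j\otimes I^{\otimes c})|S\rangle\}_{j=1}^M$ is an orthonormal basis of $\mathcal{Q}$. The isotropic subgroup of $S$ is $S_I=\{\alpha\in\mathcal{P}^n:\alpha\otimes I^{\otimes c}\in S\}$, and $WS_I=\{\omega s:\omega\in W,s\in S_I\}$. With $P$ the orthogonal projector onto $\mathcal{Q}$, for real $j\in[-1,1]$ set $S_j^{n,c}=\{\beta\in\mathcal{E}^n:P(\beta\otimes I^{\otimes c})P=jP\}$. The GS group of $\mathcal{Q}$ is $S_g=-S_{-1}^{n,c}\cup S_{+1}^{n,c}\subset\mathcal{P}^n$, where $-S_{-1}^{n,c}=\{-\beta:\beta\in S_{-1}^{n,c}\}$. *)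

theory Defs
  imports
    "Jordan_Normal_Form.VS_Connect"
    "Jordan_Normal_Form.Schur_Decomposition"
begin

definition kron :: "complex mat \<Rightarrow> complex mat \<Rightarrow> complex mat"  (infixr "\<otimes>\<^sub>k" 72) where
  "A \<otimes>\<^sub>k B = mat (dim_row A * dim_row B) (dim_col A * dim_col B)
     (\<lambda>(i, j). A $$ (i div dim_row B, j div dim_col B) * B $$ (i mod dim_row B, j mod dim_col B))"

definition sigma_x :: "complex mat" where
  "sigma_x = mat_of_rows_list 2 [[0, 1], [1, 0]]"

definition sigma_y :: "complex mat" where
  "sigma_y = mat_of_rows_list 2 [[0, - \<i>], [\<i>, 0]]"

definition sigma_z :: "complex mat" where
  "sigma_z = mat_of_rows_list 2 [[1, 0], [0, -1]]"

definition tensor_prod :: "complex mat list \<Rightarrow> complex mat" where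
  "tensor_prod ss = foldr kron ss (1\<^sub>m 1)"

definition pauli_strings :: "nat \<Rightarrow> complex mat list set" where
  "pauli_strings m = {ss. length ss = m \<and> set ss \<subseteq> {1\<^sub>m 2, sigma_x, sigma_y, sigma_z}}"

definition pauli_E :: "nat \<Rightarrow> complex mat set" where
  "pauli_E m = tensor_prod ` pauli_strings m"

definition pauli_P :: "nat \<Rightarrow> complex mat set" where
  "pauli_P m = {\<i> ^ k \<cdot>\<^sub>m \<alpha> | k \<alpha>. k \<in> {0, 1, 2, 3} \<and> \<alpha> \<in> pauli_E m}"

text \<open>A Pauli operator determines its tensor factors and its phase, so the definite
  descriptions in the next two definitions are justified on \<^term>\<open>pauli_P m\<close>.\<close>

definition phase_free :: "nat \<Rightarrow> complex mat \<Rightarrow> complex mat" where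
  "phase_free m A = (THE \<alpha>. \<alpha> \<in> pauli_E m \<and> (\<exists>k \<in> {0, 1, 2, 3}. A = \<i> ^ k \<cdot>\<^sub>m \<alpha>))"

definition pauli_wt :: "nat \<Rightarrow> complex mat \<Rightarrow> nat" where
  "pauli_wt m A = (THE w. \<exists>ss \<in> pauli_strings m. \<exists>k \<in> {0, 1, 2, 3}.
     A = \<i> ^ k \<cdot>\<^sub>m tensor_prod ss \<and> w = length (filter (\<lambda>s. s \<noteq> 1\<^sub>m 2) ss))"

text \<open>The inner product \<^term>\<open>x \<bullet>c y\<close> is conjugate-linear in its second argument: the
  bracket of \<open>u\<close> with \<open>v\<close>, conjugate-linear in \<open>u\<close>, is \<^term>\<open>v \<bullet>c u\<close>.\<close>

definition orthonormal_basis :: "nat \<Rightarrow> complex vec set \<Rightarrow> complex vec list \<Rightarrow> bool" where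
  "orthonormal_basis N Q vs \<longleftrightarrow>
     set vs \<subseteq> carrier_vec N \<and>
     (\<forall>i < length vs. \<forall>j < length vs. vs ! j \<bullet>c vs ! i = (if i = j then 1 else 0)) \<and>
     LinearCombinations.module.span class_ring (module_vec TYPE(complex) N) (set vs) = Q"

definition detectable :: "nat \<Rightarrow> complex vec set \<Rightarrow> complex mat \<Rightarrow> bool" where
  "detectable N Q E \<longleftrightarrow> (\<exists>vs. orthonormal_basis N Q vs \<and>
     (\<forall>i < length vs. \<forall>j < length vs.
        (E *\<^sub>v vs ! i) \<bullet>c vs ! i = (E *\<^sub>v vs ! j) \<bullet>c vs ! j \<and>
        (i \<noteq> j \<longrightarrow> (E *\<^sub>v vs ! j) \<bullet>c vs ! i = 0)))"

definition rank_one :: "complex vec \<Rightarrow> complex mat" where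
  "rank_one v = mat (dim_vec v) (dim_vec v) (\<lambda>(i, j). v $ i * cnj (v $ j))"

text \<open>Partial trace over the first factor of \<open>\<complex>\<^sup>a \<otimes> \<complex>\<^sup>b\<close>.\<close>

definition ptrace_fst :: "nat \<Rightarrow> nat \<Rightarrow> complex mat \<Rightarrow> complex mat" where
  "ptrace_fst a b A = mat b b (\<lambda>(i, j). \<Sum>k<a. A $$ (k * b + i, k * b + j))"

text \<open>The product of the spaces of dimensions \<open>2 ^ n\<close> and \<open>2 ^ c\<close> is identified with the
  space of dimension \<open>2 ^ (n + c)\<close> by the index convention of \<^const>\<open>kron\<close>; the bound
  \<open>< d\<close> on the weight stands for \<open>\<le> d - 1\<close> without truncated subtraction.\<close>

definition EA_code :: "nat \<Rightarrow> nat \<Rightarrow> nat \<Rightarrow> nat \<Rightarrow> complex vec set \<Rightarrow> bool" where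
  "EA_code n M d c Q \<longleftrightarrow>
     VectorSpace.subspace class_ring Q (module_vec TYPE(complex) (2 ^ (n + c))) \<and>
     vectorspace.dim class_ring (module_vec TYPE(complex) (2 ^ (n + c)) \<lparr>carrier := Q\<rparr>) = M \<and>
     (\<forall>v \<in> Q. v \<bullet>c v = 1 \<longrightarrow>
        ptrace_fst (2 ^ n) (2 ^ c) (rank_one v) = (1 / 2 ^ c) \<cdot>\<^sub>m 1\<^sub>m (2 ^ c)) \<and>
     (\<forall>\<alpha> \<in> pauli_E n. pauli_wt n \<alpha> < d \<longrightarrow> detectable (2 ^ (n + c)) Q (\<alpha> \<otimes>\<^sub>k 1\<^sub>m (2 ^ c))) \<and>
     \<not> (\<forall>\<alpha> \<in> pauli_E n. pauli_wt n \<alpha> = d \<longrightarrow> detectable (2 ^ (n + c)) Q (\<alpha> \<otimes>\<^sub>k 1\<^sub>m (2 ^ c)))"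

definition pauli_group :: "nat \<Rightarrow> complex mat monoid" where
  "pauli_group m = \<lparr>carrier = pauli_P m, monoid.mult = (*), one = 1\<^sub>m (2 ^ m)\<rparr>"

definition stabilizer_group :: "nat \<Rightarrow> complex mat set \<Rightarrow> bool" where
  "stabilizer_group m S \<longleftrightarrow> subgroup S (pauli_group m) \<and>
     (\<forall>a \<in> S. \<forall>b \<in> S. a * b = b * a) \<and> - 1\<^sub>m (2 ^ m) \<notin> S"

definition CWS_group :: "nat \<Rightarrow> complex mat set \<Rightarrow> bool" where
  "CWS_group m S \<longleftrightarrow> stabilizer_group m S \<and> (\<forall>T. stabilizer_group m T \<and> S \<subseteq> T \<longrightarrow> T = S)"

definition stabilizer_state :: "nat \<Rightarrow> complex mat set \<Rightarrow> complex vec \<Rightarrow> bool" where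
  "stabilizer_state m S v \<longleftrightarrow> v \<in> carrier_vec (2 ^ m) \<and> v \<bullet>c v = 1 \<and> (\<forall>a \<in> S. a *\<^sub>v v = v)"

text \<open>The stabilizer state of a CWS group is unique only up to a phase, and that phase is
  irrelevant to the basis condition below, so some stabilizer state is taken. The list
  \<open>ws\<close> enumerates \<open>W\<close> without repetition, so that the indexed family of translates
  is the basis.\<close>

definition EA_CWS_code ::
  "nat \<Rightarrow> nat \<Rightarrow> nat \<Rightarrow> nat \<Rightarrow> complex vec set \<Rightarrow> complex mat set \<Rightarrow> complex mat set \<Rightarrow> bool" where
  "EA_CWS_code n M d c Q S W \<longleftrightarrow>
     EA_code n M d c Q \<and> CWS_group (n + c) S \<and>
     W \<subseteq> pauli_P n \<and> 1\<^sub>m (2 ^ n) \<in> W \<and> card W = M \<and>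
     (\<forall>a \<in> W. \<forall>b \<in> W. a * b = b * a) \<and>
     (\<exists>v ws. stabilizer_state (n + c) S v \<and> set ws = W \<and> distinct ws \<and>
        orthonormal_basis (2 ^ (n + c)) Q (map (\<lambda>\<omega>. (\<omega> \<otimes>\<^sub>k 1\<^sub>m (2 ^ c)) *\<^sub>v v) ws))"

definition isotropic :: "nat \<Rightarrow> nat \<Rightarrow> complex mat set \<Rightarrow> complex mat set" where
  "isotropic n c S = {\<alpha> \<in> pauli_P n. \<alpha> \<otimes>\<^sub>k 1\<^sub>m (2 ^ c) \<in> S}"

definition set_prod :: "complex mat set \<Rightarrow> complex mat set \<Rightarrow> complex mat set" where
  "set_prod A B = {a * b | a b. a \<in> A \<and> b \<in> B}"

definition is_orth_projector :: "nat \<Rightarrow> complex vec set \<Rightarrow> complex mat \<Rightarrow> bool" where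
  "is_orth_projector N Q P \<longleftrightarrow> P \<in> carrier_mat N N \<and> P * P = P \<and> mat_adjoint P = P \<and>
     (\<lambda>x. P *\<^sub>v x) ` carrier_vec N = Q"

definition orth_projector :: "nat \<Rightarrow> complex vec set \<Rightarrow> complex mat" where
  "orth_projector N Q = (THE P. is_orth_projector N Q P)"

definition S_level :: "nat \<Rightarrow> nat \<Rightarrow> complex vec set \<Rightarrow> real \<Rightarrow> complex mat set" where
  "S_level n c Q j = (let P = orth_projector (2 ^ (n + c)) Q in
     {\<beta> \<in> pauli_E n. P * (\<beta> \<otimes>\<^sub>k 1\<^sub>m (2 ^ c)) * P = complex_of_real j \<cdot>\<^sub>m P})"

definition GS_group :: "nat \<Rightarrow> nat \<Rightarrow> complex vec set \<Rightarrow> complex mat set" where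
  "GS_group n c Q = uminus ` S_level n c Q (-1) \<union> S_level n c Q 1"

end

theory Submission
  imports Defs
begin

text \<open>If \<open>\<alpha>\<close> is the phase-free part of \<open>\<omega> s\<close>, with \<open>\<omega>\<close> a word operator and \<open>s\<close> isotropic, then up
  to phase \<open>\<alpha>\<close> sends \<open>|S\<rangle>\<close> to the basis vector \<open>\<omega>|S\<rangle>\<close>. If moreover \<open>\<alpha>\<close> is detectable, then
  \<open>P \<alpha> P = z P\<close> (Knill--Laflamme), so \<open>\<omega> \<noteq> 1\<close> would make the matrix element \<open>\<langle>S|\<omega>\<^sup>* \<alpha>|S\<rangle>\<close>, which has
  modulus one, vanish. Hence \<open>\<omega> = 1\<close>, \<open>|S\<rangle>\<close> is an eigenvector of \<open>\<alpha>\<close>, and \<open>\<alpha>\<^sup>2 = 1\<close> leaves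
  \<open>z = 1\<close> or \<open>z = -1\<close>, that is, \<open>\<alpha> \<in> \<phi>(S\<^sub>g)\<close>. So the elements of \<open>\<phi>(WS\<^sub>I) - \<phi>(S\<^sub>g)\<close> are not
  detectable and have weight at least \<open>d\<close>.\<close>

section \<open>Kronecker products\<close>

lemma kron_carrier:
  "A \<in> carrier_mat a b \<Longrightarrow> B \<in> carrier_mat p q \<Longrightarrow> A \<otimes>\<^sub>k B \<in> carrier_mat (a * p) (b * q)"
  by (auto simp: kron_def)

lemma kron_index:
  assumes "A \<in> carrier_mat a b" "B \<in> carrier_mat p q" "i < a * p" "j < b * q"
  shows "(A \<otimes>\<^sub>k B) $$ (i, j) = A $$ (i div p, j div q) * B $$ (i mod p, j mod q)"
  using assms by (auto simp: kron_def)

lemma block_index_less: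
  fixes i a k p :: nat
  assumes "i < a" "k < p"
  shows "i * p + k < a * p"
proof -
  have "i * p + k < Suc i * p" using assms by simp
  also have "\<dots> \<le> a * p" using assms by (intro mult_le_mono1) simp
  finally show ?thesis .
qed

text \<open>Writing an index as block number times block size plus offset removes \<open>div\<close>
  and \<open>mod\<close>, so that the two tensor factors of an entry can be varied
  independently.\<close>

lemma kron_block_index:
  assumes "A \<in> carrier_mat a b" "B \<in> carrier_mat p q" "i < a" "j < b" "k < p" "l < q"
  shows "(A \<otimes>\<^sub>k B) $$ (i * p + k, j * q + l) = A $$ (i, j) * B $$ (k, l)"
  using assms by (subst kron_index[OF assms(1,2)]) (auto simp: block_index_less)

text \<open>Division with remainder by \<open>n\<close> is a bijection from the indices below
  \<open>m * n\<close> to pairs, and a double sum of products splits. For \<open>n = 0\<close> both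
  sides are zero.\<close>

lemma sum_div_mod:
  fixes f g :: "nat \<Rightarrow> 'a::comm_semiring_0"
  shows "(\<Sum>k<m * n. f (k div n) * g (k mod n)) = (\<Sum>i<m. f i) * (\<Sum>j<n. g j)"
proof -
  have "(\<Sum>k<m * n. f (k div n) * g (k mod n)) = (\<Sum>(i, j)\<in>{..<m} \<times> {..<n}. f i * g j)"
  proof (rule sum.reindex_bij_witness[where i = "\<lambda>(i, j). i * n + j" and j = "\<lambda>k. (k div n, k mod n)"])
    fix k assume "k \<in> {..<m * n}"
    then show "(k div n, k mod n) \<in> {..<m} \<times> {..<n}"
      by (cases "n = 0") (auto simp: less_mult_imp_div_less)
  qed (auto simp: block_index_less)
  then show ?thesis by (simp add: sum_product sum.cartesian_product)
qed

text \<open>The mixed-product rule. In the sum over the inner index \<open>k\<close>, each term is a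
  function of \<open>k div q\<close> times a function of \<open>k mod q\<close>, which is the shape
  that \<open>sum_div_mod\<close> factors.\<close>

lemma kron_mult:
  assumes A: "A \<in> carrier_mat a b" and B: "B \<in> carrier_mat p q"
    and C: "C \<in> carrier_mat b r" and D: "D \<in> carrier_mat q t"
  shows "(A \<otimes>\<^sub>k B) * (C \<otimes>\<^sub>k D) = (A * C) \<otimes>\<^sub>k (B * D)"
proof (rule eq_matI)
  note AB = kron_carrier[OF A B] and CD = kron_carrier[OF C D]
  have AC: "A * C \<in> carrier_mat a r" and BD: "B * D \<in> carrier_mat p t" using assms by auto
  note P = kron_carrier[OF AC BD]
  show "dim_row ((A \<otimes>\<^sub>k B) * (C \<otimes>\<^sub>k D)) = dim_row ((A * C) \<otimes>\<^sub>k (B * D))"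
    "dim_col ((A \<otimes>\<^sub>k B) * (C \<otimes>\<^sub>k D)) = dim_col ((A * C) \<otimes>\<^sub>k (B * D))"
    using AB CD P by auto
  fix i j assume "i < dim_row ((A * C) \<otimes>\<^sub>k (B * D))" "j < dim_col ((A * C) \<otimes>\<^sub>k (B * D))"
  then have ij: "i < a * p" "j < r * t" using P by auto
  \<comment> \<open>An index in range rules out empty factors; the bounds on the remainders depend
    on this.\<close>
  then have pt: "p > 0" "t > 0" by (auto intro: gr0I)
  have d: "i div p < a" "i mod p < p" "j div t < r" "j mod t < t"
    using ij pt by (auto simp: less_mult_imp_div_less)
  have "((A \<otimes>\<^sub>k B) * (C \<otimes>\<^sub>k D)) $$ (i, j) = (\<Sum>k<b * q. (A \<otimes>\<^sub>k B) $$ (i, k) * (C \<otimes>\<^sub>k D) $$ (k, j))"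
    using AB CD ij by (auto simp: scalar_prod_def lessThan_atLeast0)
  also have "\<dots> = (\<Sum>k<b * q. (A $$ (i div p, k div q) * C $$ (k div q, j div t)) *
      (B $$ (i mod p, k mod q) * D $$ (k mod q, j mod t)))"
    by (intro sum.cong refl) (simp add: kron_index[OF A B] kron_index[OF C D] ij)
  also have "\<dots> = (\<Sum>k<b. A $$ (i div p, k) * C $$ (k, j div t)) *
      (\<Sum>k<q. B $$ (i mod p, k) * D $$ (k, j mod t))"
    by (rule sum_div_mod)
  also have "\<dots> = (A * C) $$ (i div p, j div t) * (B * D) $$ (i mod p, j mod t)"
    using assms d by (auto simp: scalar_prod_def lessThan_atLeast0)
  also have "\<dots> = ((A * C) \<otimes>\<^sub>k (B * D)) $$ (i, j)"
    using kron_index[OF AC BD ij] by simp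
  finally show "((A \<otimes>\<^sub>k B) * (C \<otimes>\<^sub>k D)) $$ (i, j) = ((A * C) \<otimes>\<^sub>k (B * D)) $$ (i, j)" .
qed

lemma smult_smult_mat:
  fixes A :: "'a::semigroup_mult mat"
  shows "a \<cdot>\<^sub>m (b \<cdot>\<^sub>m A) = (a * b) \<cdot>\<^sub>m A"
  by (rule eq_matI) (auto simp: mult.assoc)

lemma smult_mat_mult_vec:
  fixes A :: "complex mat"
  assumes "A \<in> carrier_mat a b" "v \<in> carrier_vec b"
  shows "(z \<cdot>\<^sub>m A) *\<^sub>v v = z \<cdot>\<^sub>v (A *\<^sub>v v)"
  using assms by (intro eq_vecI) (auto simp: scalar_prod_def sum_distrib_left mult.assoc)

lemma smult_kron: "(z \<cdot>\<^sub>m A) \<otimes>\<^sub>k (w \<cdot>\<^sub>m B) = (z * w) \<cdot>\<^sub>m (A \<otimes>\<^sub>k B)"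
proof (rule eq_matI)
  fix i j assume "i < dim_row ((z * w) \<cdot>\<^sub>m (A \<otimes>\<^sub>k B))" "j < dim_col ((z * w) \<cdot>\<^sub>m (A \<otimes>\<^sub>k B))"
  then have ij: "i < dim_row A * dim_row B" "j < dim_col A * dim_col B" by (auto simp: kron_def)
  then have "dim_row B > 0" "dim_col B > 0" by (auto intro: gr0I)
  then show "((z \<cdot>\<^sub>m A) \<otimes>\<^sub>k (w \<cdot>\<^sub>m B)) $$ (i, j) = ((z * w) \<cdot>\<^sub>m (A \<otimes>\<^sub>k B)) $$ (i, j)"
    using ij by (auto simp: kron_def less_mult_imp_div_less)
qed (auto simp: kron_def)

lemma smult_kron_left: "(z \<cdot>\<^sub>m A) \<otimes>\<^sub>k B = z \<cdot>\<^sub>m (A \<otimes>\<^sub>k B)"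
proof -
  have "1 \<cdot>\<^sub>m B = B" by (rule eq_matI) auto
  then show ?thesis using smult_kron[of z A 1 B] by simp
qed

lemma kron_one: "1\<^sub>m a \<otimes>\<^sub>k 1\<^sub>m b = 1\<^sub>m (a * b)"
proof (rule eq_matI)
  fix i j assume "i < dim_row (1\<^sub>m (a * b) :: complex mat)" "j < dim_col (1\<^sub>m (a * b) :: complex mat)"
  then have ij: "i < a * b" "j < a * b" by auto
  then have "b > 0" by (auto intro: gr0I)
  moreover have "i div b = j div b \<and> i mod b = j mod b \<longleftrightarrow> i = j"
    by (metis div_mult_mod_eq)
  ultimately show "(1\<^sub>m a \<otimes>\<^sub>k 1\<^sub>m b) $$ (i, j) = (1\<^sub>m (a * b) :: complex mat) $$ (i, j)"
    using ij by (subst kron_index[of _ a a _ b b]) (auto simp: less_mult_imp_div_less)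
qed (auto simp: kron_def)

section \<open>Pauli operators\<close>

lemma pauli_entries:
  "dim_row sigma_x = 2" "dim_col sigma_x = 2" "dim_row sigma_y = 2" "dim_col sigma_y = 2"
  "dim_row sigma_z = 2" "dim_col sigma_z = 2"
  "sigma_x $$ (0, 0) = 0" "sigma_x $$ (0, Suc 0) = 1" "sigma_x $$ (Suc 0, 0) = 1" "sigma_x $$ (Suc 0, Suc 0) = 0"
  "sigma_y $$ (0, 0) = 0" "sigma_y $$ (0, Suc 0) = - \<i>" "sigma_y $$ (Suc 0, 0) = \<i>" "sigma_y $$ (Suc 0, Suc 0) = 0"
  "sigma_z $$ (0, 0) = 1" "sigma_z $$ (0, Suc 0) = 0" "sigma_z $$ (Suc 0, 0) = 0" "sigma_z $$ (Suc 0, Suc 0) = - 1"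
  by (auto simp: sigma_x_def sigma_y_def sigma_z_def mat_of_rows_list_def)

lemma pauli_factor_carrier: "s \<in> {1\<^sub>m 2, sigma_x, sigma_y, sigma_z} \<Longrightarrow> s \<in> carrier_mat 2 2"
  by (auto simp: pauli_entries)

lemma mat2_eqI:
  assumes "A \<in> carrier_mat 2 2" "B \<in> carrier_mat 2 2"
    "A $$ (0, 0) = B $$ (0, 0)" "A $$ (0, Suc 0) = B $$ (0, Suc 0)"
    "A $$ (Suc 0, 0) = B $$ (Suc 0, 0)" "A $$ (Suc 0, Suc 0) = B $$ (Suc 0, Suc 0)"
  shows "A = B"
  using assms by (intro eq_matI) (auto simp: less_Suc_eq numeral_2_eq_2)

lemma mat2_mult_entries:
  fixes A B :: "complex mat"
  assumes "A \<in> carrier_mat 2 2" "B \<in> carrier_mat 2 2" "i < 2" "j < 2"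
  shows "(A * B) $$ (i, j) = A $$ (i, 0) * B $$ (0, j) + A $$ (i, Suc 0) * B $$ (Suc 0, j)"
  using assms by (auto simp: scalar_prod_def numeral_2_eq_2)

text \<open>The exponent \<open>k\<close> ranges over all naturals, so that the phases of the
  factors of a tensor product can simply be added; reduction modulo 4 is postponed to
  \<open>imag_power_mod4\<close>.\<close>

lemma pauli_factor_mult:
  assumes "s \<in> {1\<^sub>m 2, sigma_x, sigma_y, sigma_z}" "t \<in> {1\<^sub>m 2, sigma_x, sigma_y, sigma_z}"
  shows "\<exists>k. \<exists>u \<in> {1\<^sub>m 2, sigma_x, sigma_y, sigma_z}. s * t = \<i> ^ k \<cdot>\<^sub>m u"
proof -
  have p: "\<i> ^ 3 = - \<i>" by (simp add: power3_eq_cube)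
  have one: "\<And>A. A \<in> carrier_mat 2 2 \<Longrightarrow> A = \<i> ^ 0 \<cdot>\<^sub>m A" by (rule eq_matI) auto
  \<comment> \<open>The library rule for entries of a product is switched off below, so that
    \<open>mat2_mult_entries\<close> expands each entry into two explicit terms.\<close>
  have xy: "sigma_x * sigma_y = \<i> ^ 1 \<cdot>\<^sub>m sigma_z" and yx: "sigma_y * sigma_x = \<i> ^ 3 \<cdot>\<^sub>m sigma_z"
    and yz: "sigma_y * sigma_z = \<i> ^ 1 \<cdot>\<^sub>m sigma_x" and zy: "sigma_z * sigma_y = \<i> ^ 3 \<cdot>\<^sub>m sigma_x"
    and zx: "sigma_z * sigma_x = \<i> ^ 1 \<cdot>\<^sub>m sigma_y" and xz: "sigma_x * sigma_z = \<i> ^ 3 \<cdot>\<^sub>m sigma_y"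
    and xx: "sigma_x * sigma_x = \<i> ^ 0 \<cdot>\<^sub>m 1\<^sub>m 2" and yy: "sigma_y * sigma_y = \<i> ^ 0 \<cdot>\<^sub>m 1\<^sub>m 2"
    and zz: "sigma_z * sigma_z = \<i> ^ 0 \<cdot>\<^sub>m 1\<^sub>m 2"
    by (rule mat2_eqI; simp add: mat2_mult_entries pauli_entries pauli_factor_carrier p carrier_matI
        del: index_mult_mat(1))+
  consider "s = 1\<^sub>m 2" | "t = 1\<^sub>m 2" | "s \<in> {sigma_x, sigma_y, sigma_z}" "t \<in> {sigma_x, sigma_y, sigma_z}"
    using assms by auto
  then show ?thesis
  proof cases
    case 1
    then have "s * t = \<i> ^ 0 \<cdot>\<^sub>m t" using pauli_factor_carrier[OF assms(2)] one by simp
    then show ?thesis using assms(2) by blast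
  next
    case 2
    then have "s * t = \<i> ^ 0 \<cdot>\<^sub>m s" using pauli_factor_carrier[OF assms(1)] one by simp
    then show ?thesis using assms(1) by blast
  next
    case 3
    then show ?thesis using xy yx yz zy zx xz xx yy zz by blast
  qed
qed

lemma pauli_factor_square:
  assumes "s \<in> {1\<^sub>m 2, sigma_x, sigma_y, sigma_z}"
  shows "s * s = 1\<^sub>m 2"
proof -
  have "sigma_x * sigma_x = 1\<^sub>m 2" "sigma_y * sigma_y = 1\<^sub>m 2" "sigma_z * sigma_z = 1\<^sub>m 2"
    by (rule mat2_eqI; simp add: mat2_mult_entries pauli_entries pauli_factor_carrier carrier_matI
        del: index_mult_mat(1))+
  then show ?thesis using assms by auto
qed

section \<open>Tensor products of Pauli matrices\<close>

lemma tensor_prod_Cons: "tensor_prod (s # ss) = s \<otimes>\<^sub>k tensor_prod ss"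
  by (simp add: tensor_prod_def)

lemma pauli_strings_Cons:
  "s # ss \<in> pauli_strings (Suc m) \<longleftrightarrow>
    s \<in> {1\<^sub>m 2, sigma_x, sigma_y, sigma_z} \<and> ss \<in> pauli_strings m"
  by (auto simp: pauli_strings_def)

lemma pauli_strings_SucE:
  assumes "ss \<in> pauli_strings (Suc m)"
  obtains s ts where "ss = s # ts" "s \<in> {1\<^sub>m 2, sigma_x, sigma_y, sigma_z}" "ts \<in> pauli_strings m"
  using assms by (cases ss) (auto simp: pauli_strings_def)

lemma tensor_prod_carrier: "ss \<in> pauli_strings m \<Longrightarrow> tensor_prod ss \<in> carrier_mat (2 ^ m) (2 ^ m)"
proof (induction m arbitrary: ss)
  case 0
  then show ?case by (simp add: pauli_strings_def tensor_prod_def)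
next
  case (Suc m)
  from Suc.prems obtain s ts where "ss = s # ts" "s \<in> {1\<^sub>m 2, sigma_x, sigma_y, sigma_z}"
    "ts \<in> pauli_strings m" by (rule pauli_strings_SucE)
  with kron_carrier[OF pauli_factor_carrier Suc.IH] show ?case by (simp add: tensor_prod_Cons)
qed

lemma tensor_prod_mult:
  "ss \<in> pauli_strings m \<Longrightarrow> ts \<in> pauli_strings m \<Longrightarrow>
    \<exists>k. \<exists>us \<in> pauli_strings m. tensor_prod ss * tensor_prod ts = \<i> ^ k \<cdot>\<^sub>m tensor_prod us"
proof (induction m arbitrary: ss ts)
  case 0
  then show ?case by (auto simp: pauli_strings_def tensor_prod_def intro!: exI[of _ 0] eq_matI)
next
  case (Suc m)
  from Suc.prems(1) obtain s ss' where s: "ss = s # ss'" "s \<in> {1\<^sub>m 2, sigma_x, sigma_y, sigma_z}"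
    "ss' \<in> pauli_strings m" by (rule pauli_strings_SucE)
  from Suc.prems(2) obtain t ts' where t: "ts = t # ts'" "t \<in> {1\<^sub>m 2, sigma_x, sigma_y, sigma_z}"
    "ts' \<in> pauli_strings m" by (rule pauli_strings_SucE)
  from pauli_factor_mult[OF s(2) t(2)] obtain k u
    where u: "u \<in> {1\<^sub>m 2, sigma_x, sigma_y, sigma_z}" "s * t = \<i> ^ k \<cdot>\<^sub>m u" by blast
  from Suc.IH[OF s(3) t(3)] obtain l us
    where us: "us \<in> pauli_strings m" "tensor_prod ss' * tensor_prod ts' = \<i> ^ l \<cdot>\<^sub>m tensor_prod us" by blast
  have "tensor_prod ss * tensor_prod ts = (s * t) \<otimes>\<^sub>k (tensor_prod ss' * tensor_prod ts')"
    unfolding s(1) t(1) tensor_prod_Cons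
    by (rule kron_mult[OF pauli_factor_carrier[OF s(2)] tensor_prod_carrier[OF s(3)]
          pauli_factor_carrier[OF t(2)] tensor_prod_carrier[OF t(3)]])
  also have "\<dots> = \<i> ^ (k + l) \<cdot>\<^sub>m tensor_prod (u # us)"
    by (simp add: u us smult_kron tensor_prod_Cons power_add)
  finally show ?case using u us pauli_strings_Cons by blast
qed

lemma tensor_prod_square: "ss \<in> pauli_strings m \<Longrightarrow> tensor_prod ss * tensor_prod ss = 1\<^sub>m (2 ^ m)"
proof (induction m arbitrary: ss)
  case 0
  then show ?case by (auto simp: pauli_strings_def tensor_prod_def)
next
  case (Suc m)
  from Suc.prems obtain s ts where s: "ss = s # ts" "s \<in> {1\<^sub>m 2, sigma_x, sigma_y, sigma_z}"
    "ts \<in> pauli_strings m" by (rule pauli_strings_SucE)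
  have "tensor_prod ss * tensor_prod ss = (s * s) \<otimes>\<^sub>k (tensor_prod ts * tensor_prod ts)"
    unfolding s(1) tensor_prod_Cons
    by (rule kron_mult[OF pauli_factor_carrier[OF s(2)] tensor_prod_carrier[OF s(3)]
          pauli_factor_carrier[OF s(2)] tensor_prod_carrier[OF s(3)]])
  also have "\<dots> = 1\<^sub>m (2 ^ Suc m)"
    using Suc.IH[OF s(3)] pauli_factor_square[OF s(2)] by (simp add: kron_one)
  finally show ?case .
qed

text \<open>A zero matrix could not square to the identity. The nonzero entry found here is what
  \<open>tensor_prod_scalar_inj\<close> cancels.\<close>

lemma tensor_prod_nonzero:
  assumes "ss \<in> pauli_strings m"
  obtains p q where "p < 2 ^ m" "q < 2 ^ m" "tensor_prod ss $$ (p, q) \<noteq> 0"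
proof -
  have "\<exists>p < 2 ^ m. \<exists>q < 2 ^ m. tensor_prod ss $$ (p, q) \<noteq> 0"
  proof (rule ccontr)
    assume "\<not> ?thesis"
    then have z: "tensor_prod ss = 0\<^sub>m (2 ^ m) (2 ^ m)"
      using tensor_prod_carrier[OF assms] by (intro eq_matI) auto
    have "(tensor_prod ss * tensor_prod ss) $$ (0, 0) = 0"
      using z by simp
    with tensor_prod_square[OF assms] show False by simp
  qed
  with that show ?thesis by blast
qed

text \<open>Distinct Pauli matrices are not proportional, so heads can be compared and cancelled one
  at a time. Allowing a scalar \<open>z\<close> covers Pauli operators that differ by a phase, and
  the same \<open>z\<close> passes through the induction.\<close>

lemma tensor_prod_scalar_inj:
  "ss \<in> pauli_strings m \<Longrightarrow> ts \<in> pauli_strings m \<Longrightarrow>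
    tensor_prod ss = z \<cdot>\<^sub>m tensor_prod ts \<Longrightarrow> ss = ts"
proof (induction m arbitrary: ss ts)
  case 0
  then show ?case by (simp add: pauli_strings_def)
next
  case (Suc m)
  from Suc.prems(1) obtain s ss' where s: "ss = s # ss'" "s \<in> {1\<^sub>m 2, sigma_x, sigma_y, sigma_z}"
    "ss' \<in> pauli_strings m" by (rule pauli_strings_SucE)
  from Suc.prems(2) obtain t ts' where t: "ts = t # ts'" "t \<in> {1\<^sub>m 2, sigma_x, sigma_y, sigma_z}"
    "ts' \<in> pauli_strings m" by (rule pauli_strings_SucE)
  note sc = pauli_factor_carrier[OF s(2)] tensor_prod_carrier[OF s(3)]
  note tc = pauli_factor_carrier[OF t(2)] tensor_prod_carrier[OF t(3)]
  have eq: "s $$ (i, j) * tensor_prod ss' $$ (p, q) = z * (t $$ (i, j) * tensor_prod ts' $$ (p, q))"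
    if "i < 2" "j < 2" "p < 2 ^ m" "q < 2 ^ m" for i j p q
  proof -
    have "(s \<otimes>\<^sub>k tensor_prod ss') $$ (i * 2 ^ m + p, j * 2 ^ m + q) =
        (z \<cdot>\<^sub>m (t \<otimes>\<^sub>k tensor_prod ts')) $$ (i * 2 ^ m + p, j * 2 ^ m + q)"
      using Suc.prems(3) by (simp add: s(1) t(1) tensor_prod_Cons)
    also have "\<dots> = z * (t \<otimes>\<^sub>k tensor_prod ts') $$ (i * 2 ^ m + p, j * 2 ^ m + q)"
      by (rule index_smult_mat)
        (simp_all only: carrier_matD[OF kron_carrier[OF tc]] block_index_less that)
    finally show ?thesis by (simp only: kron_block_index[OF sc that] kron_block_index[OF tc that])
  qed
  \<comment> \<open>At a fixed nonzero entry of the tail, the four blocks show the entries of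
    \<open>s\<close> to be a common multiple of those of \<open>t\<close>. The positions of the
    zeros separate the diagonal from the off-diagonal Pauli matrices, and the ratio of the two
    nonzero entries separates the rest.\<close>
  obtain p q where pq: "p < 2 ^ m" "q < 2 ^ m" "tensor_prod ss' $$ (p, q) \<noteq> 0"
    using tensor_prod_nonzero[OF s(3)] .
  have st: "s = t"
    using s(2) t(2) eq[of 0 0 p q] eq[of 0 "Suc 0" p q] eq[of "Suc 0" 0 p q] eq[of "Suc 0" "Suc 0" p q] pq
    by (auto simp: pauli_entries)
  \<comment> \<open>A nonzero entry in the first row of the common head is divided out to leave the
    proportionality of the tails.\<close>
  have "t $$ (0, 0) \<noteq> 0 \<or> t $$ (0, Suc 0) \<noteq> 0"
    using t(2) by (auto simp: pauli_entries)
  then have "\<exists>j<2. t $$ (0, j) \<noteq> 0" by (metis One_nat_def one_less_numeral_iff pos2 semiring_norm(76))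
  then obtain j where ij: "(0 :: nat) < 2" "j < 2" "t $$ (0, j) \<noteq> 0" by auto
  have "tensor_prod ss' = z \<cdot>\<^sub>m tensor_prod ts'"
    using sc tc eq[OF ij(1,2)] ij(3) by (intro eq_matI) (auto simp: st)
  from Suc.IH[OF s(3) t(3) this] st show ?case by (simp add: s t)
qed

section \<open>Pauli operators with and without phases\<close>

lemma pauli_E_carrier: "\<alpha> \<in> pauli_E m \<Longrightarrow> \<alpha> \<in> carrier_mat (2 ^ m) (2 ^ m)"
  by (auto simp: pauli_E_def tensor_prod_carrier)

lemma pauli_P_carrier: "A \<in> pauli_P m \<Longrightarrow> A \<in> carrier_mat (2 ^ m) (2 ^ m)"
  by (auto simp: pauli_P_def dest: pauli_E_carrier)

lemma pauli_P_I: "\<alpha> \<in> pauli_E m \<Longrightarrow> k \<in> {0, 1, 2, 3} \<Longrightarrow> \<i> ^ k \<cdot>\<^sub>m \<alpha> \<in> pauli_P m"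
  unfolding pauli_P_def by blast

lemma pauli_P_E:
  assumes "A \<in> pauli_P m"
  obtains k \<alpha> where "A = \<i> ^ k \<cdot>\<^sub>m \<alpha>" "\<alpha> \<in> pauli_E m" "k \<in> {0, 1, 2, 3}"
  using assms unfolding pauli_P_def by blast

lemma pauli_E_square: "\<alpha> \<in> pauli_E m \<Longrightarrow> \<alpha> * \<alpha> = 1\<^sub>m (2 ^ m)"
  by (auto simp: pauli_E_def tensor_prod_square)

text \<open>Makes the minimum in the final bound one over a finite set.\<close>

lemma finite_pauli_E: "finite (pauli_E m)"
proof -
  have "finite (pauli_strings m)"
    using finite_lists_length_eq[of "{1\<^sub>m 2, sigma_x, sigma_y, sigma_z}" m]
    by (simp add: pauli_strings_def conj_commute)
  then show ?thesis by (simp add: pauli_E_def)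
qed

lemma imag_power_mod4: "\<exists>l \<in> {0, 1, 2, 3}. \<i> ^ k = \<i> ^ l"
proof
  have "\<i> ^ k = \<i> ^ (4 * (k div 4) + k mod 4)" by simp
  also have "\<dots> = \<i> ^ (k mod 4)" by (simp only: power_add power_mult) simp
  finally show "\<i> ^ k = \<i> ^ (k mod 4)" .
  show "k mod 4 \<in> {0, 1, 2, 3}" by auto
qed

lemma pauli_P_mult:
  assumes "A \<in> pauli_P m" "B \<in> pauli_P m"
  shows "A * B \<in> pauli_P m"
proof -
  obtain k \<alpha> where A: "A = \<i> ^ k \<cdot>\<^sub>m \<alpha>" "\<alpha> \<in> pauli_E m" using assms(1) by (rule pauli_P_E)
  obtain l \<beta> where B: "B = \<i> ^ l \<cdot>\<^sub>m \<beta>" "\<beta> \<in> pauli_E m" using assms(2) by (rule pauli_P_E)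
  obtain r \<gamma> where C: "\<alpha> * \<beta> = \<i> ^ r \<cdot>\<^sub>m \<gamma>" "\<gamma> \<in> pauli_E m"
    using A(2) B(2) tensor_prod_mult by (force simp: pauli_E_def)
  have "A * B = (\<i> ^ k * \<i> ^ l) \<cdot>\<^sub>m (\<alpha> * \<beta>)"
    using A B pauli_E_carrier[OF A(2)] pauli_E_carrier[OF B(2)]
    by (auto simp: mult_smult_distrib mult_smult_assoc_mat smult_smult_mat ac_simps)
  also have "\<dots> = \<i> ^ (k + l + r) \<cdot>\<^sub>m \<gamma>"
    by (simp add: C smult_smult_mat power_add ac_simps)
  finally show ?thesis using imag_power_mod4[of "k + l + r"] pauli_P_I[OF C(2)] by metis
qed

text \<open>Two phase-free operators that agree up to phases are proportional, hence equal by
  \<open>tensor_prod_scalar_inj\<close>; this justifies the definite description.\<close>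

lemma phase_free_eq:
  assumes "\<alpha> \<in> pauli_E m" "k \<in> {0, 1, 2, 3}"
  shows "phase_free m (\<i> ^ k \<cdot>\<^sub>m \<alpha>) = \<alpha>"
  unfolding phase_free_def
proof (rule the_equality)
  fix \<beta> assume "\<beta> \<in> pauli_E m \<and> (\<exists>l \<in> {0, 1, 2, 3}. \<i> ^ k \<cdot>\<^sub>m \<alpha> = \<i> ^ l \<cdot>\<^sub>m \<beta>)"
  then obtain l where l: "\<beta> \<in> pauli_E m" "\<i> ^ k \<cdot>\<^sub>m \<alpha> = \<i> ^ l \<cdot>\<^sub>m \<beta>" by blast
  have "\<beta> = inverse (\<i> ^ l) \<cdot>\<^sub>m (\<i> ^ l \<cdot>\<^sub>m \<beta>)" by (rule eq_matI) auto
  also have "\<dots> = (inverse (\<i> ^ l) * \<i> ^ k) \<cdot>\<^sub>m \<alpha>" by (simp only: l(2)[symmetric] smult_smult_mat)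
  finally show "\<beta> = \<alpha>"
    using l(1) assms(1) tensor_prod_scalar_inj unfolding pauli_E_def by (metis (no_types, lifting) imageE)
qed (use assms in blast)

lemma phase_free_pauli_E:
  assumes "\<alpha> \<in> pauli_E m"
  shows "phase_free m \<alpha> = \<alpha>" "phase_free m (- \<alpha>) = \<alpha>"
proof -
  have "\<i> ^ 0 \<cdot>\<^sub>m \<alpha> = \<alpha>" "\<i> ^ 2 \<cdot>\<^sub>m \<alpha> = - \<alpha>" by (auto intro!: eq_matI)
  with phase_free_eq[OF assms, of 0] phase_free_eq[OF assms, of 2]
  show "phase_free m \<alpha> = \<alpha>" "phase_free m (- \<alpha>) = \<alpha>" by simp_all
qed

text \<open>Dropping phases undoes the minus sign put on the level \<open>-1\<close>, so membership
  becomes a condition on the compression by the projector alone.\<close>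

lemma phase_free_GS_group: "phase_free n ` GS_group n c Q = S_level n c Q (-1) \<union> S_level n c Q 1"
proof -
  have "S_level n c Q j \<subseteq> pauli_E n" for j by (auto simp: S_level_def Let_def)
  then show ?thesis
    by (force simp: GS_group_def image_Un image_image phase_free_pauli_E)
qed

section \<open>Orthogonal projectors\<close>

lemma mat_adjoint_dim: "dim_row (mat_adjoint A) = dim_col A" "dim_col (mat_adjoint A) = dim_row A"
  by (auto simp: mat_adjoint_def)

lemma mat_adjoint_carrier: "A \<in> carrier_mat a b \<Longrightarrow> mat_adjoint A \<in> carrier_mat b a"
  unfolding carrier_mat_def by (simp add: mat_adjoint_dim)

lemma mat_adjoint_index:
  "i < dim_col A \<Longrightarrow> j < dim_row A \<Longrightarrow> mat_adjoint A $$ (i, j) = conjugate (A $$ (j, i))"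
  by (simp add: mat_adjoint_def mat_of_rows_index)

lemma mat_adjoint_adjoint: "mat_adjoint (mat_adjoint A) = A"
  by (rule eq_matI) (auto simp: mat_adjoint_dim mat_adjoint_index)

lemma mat_adjoint_mult:
  fixes A B :: "complex mat"
  assumes "A \<in> carrier_mat a b" "B \<in> carrier_mat b r"
  shows "mat_adjoint (A * B) = mat_adjoint B * mat_adjoint A"
  using assms
  by (intro eq_matI)
    (auto simp: mat_adjoint_dim mat_adjoint_index scalar_prod_def cnj_sum mult.commute intro!: sum.cong)

lemma cscalar_prod_adjoint:
  fixes A :: "complex mat"
  assumes "A \<in> carrier_mat a b" "x \<in> carrier_vec b" "y \<in> carrier_vec a"
  shows "(A *\<^sub>v x) \<bullet>c y = x \<bullet>c (mat_adjoint A *\<^sub>v y)"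
proof -
  have "(A *\<^sub>v x) \<bullet>c y = (\<Sum>i<a. \<Sum>j<b. A $$ (i, j) * x $ j * cnj (y $ i))"
    using assms by (auto simp: scalar_prod_def lessThan_atLeast0 sum_distrib_right)
  also have "\<dots> = (\<Sum>j<b. \<Sum>i<a. A $$ (i, j) * x $ j * cnj (y $ i))"
    by (rule sum.swap)
  also have "\<dots> = x \<bullet>c (mat_adjoint A *\<^sub>v y)"
    using assms by (auto simp: scalar_prod_def lessThan_atLeast0 sum_distrib_left cnj_sum
        mat_adjoint_dim mat_adjoint_index ac_simps intro!: sum.cong)
  finally show ?thesis .
qed

section \<open>Projectors onto a code space and compressions of operators\<close>

lemma is_orth_projector_fixes:
  assumes "is_orth_projector N Q P" "x \<in> Q"
  shows "P *\<^sub>v x = x"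
proof -
  obtain y where y: "y \<in> carrier_vec N" "x = P *\<^sub>v y"
    using assms by (auto simp: is_orth_projector_def)
  have P: "P \<in> carrier_mat N N" "P * P = P" using assms by (auto simp: is_orth_projector_def)
  then show ?thesis using y(1) by (simp add: y(2) flip: assoc_mult_mat_vec[of P N N P N])
qed

text \<open>By idempotence each column of \<open>R\<close> is \<open>R\<close> applied to that
  column, so it lies in \<open>Q\<close> and is fixed by \<open>P\<close>.\<close>

lemma is_orth_projector_absorb:
  assumes P: "is_orth_projector N Q P" and R: "is_orth_projector N Q R"
  shows "P * R = R"
proof (rule eq_matI)
  have c: "P \<in> carrier_mat N N" "R \<in> carrier_mat N N"
    using assms by (auto simp: is_orth_projector_def)
  fix i j assume ij: "i < dim_row R" "j < dim_col R"
  have "R * R = R" using R by (simp add: is_orth_projector_def)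
  then have "col R j = R *\<^sub>v col R j" using c ij col_mult2[of R N N R N j] by simp
  moreover have "col R j \<in> carrier_vec N" using c by auto
  ultimately have "col R j \<in> Q" using R unfolding is_orth_projector_def by (metis imageI)
  then have "P *\<^sub>v col R j = col R j" by (rule is_orth_projector_fixes[OF P])
  then have "(P *\<^sub>v col R j) $ i = col R j $ i" by simp
  then show "(P * R) $$ (i, j) = R $$ (i, j)" using c ij by auto
qed (use assms in \<open>auto simp: is_orth_projector_def\<close>)

text \<open>Self-adjointness turns \<open>P * R = R\<close> into \<open>R * P = R\<close>, while
  absorption with the roles exchanged gives \<open>R * P = P\<close>.\<close>

lemma is_orth_projector_unique:
  assumes P: "is_orth_projector N Q P" and R: "is_orth_projector N Q R"
  shows "P = R"
proof -
  have c: "P \<in> carrier_mat N N" "R \<in> carrier_mat N N" "mat_adjoint P = P" "mat_adjoint R = R"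
    using assms by (auto simp: is_orth_projector_def)
  have "R = mat_adjoint (P * R)" using is_orth_projector_absorb[OF P R] c by simp
  also have "\<dots> = R * P" using c by (simp add: mat_adjoint_mult[of P N N R N])
  also have "\<dots> = P" by (rule is_orth_projector_absorb[OF R P])
  finally show ?thesis by simp
qed

lemma orth_projector_eq: "is_orth_projector N Q P \<Longrightarrow> orth_projector N Q = P"
  unfolding orth_projector_def by (rule the_equality) (auto intro: is_orth_projector_unique)

text \<open>Vectors of \<open>Q\<close> are fixed by the self-adjoint \<open>P\<close>, so inserting
  \<open>P\<close> on both sides of \<open>E\<close> leaves the matrix element unchanged.\<close>

lemma compression_cscalar_prod:
  assumes P: "is_orth_projector N Q P" and E: "E \<in> carrier_mat N N"
    and PEP: "P * E * P = z \<cdot>\<^sub>m P" and x: "x \<in> Q" and y: "y \<in> Q"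
  shows "(E *\<^sub>v x) \<bullet>c y = z * (x \<bullet>c y)"
proof -
  have c: "P \<in> carrier_mat N N" "mat_adjoint P = P" and Q: "Q \<subseteq> carrier_vec N"
    using P by (auto simp: is_orth_projector_def)
  have xy: "x \<in> carrier_vec N" "y \<in> carrier_vec N" using Q x y by auto
  note fixed = is_orth_projector_fixes[OF P]
  have "(E *\<^sub>v x) \<bullet>c y = (E *\<^sub>v x) \<bullet>c (mat_adjoint P *\<^sub>v y)" by (simp add: c fixed[OF y])
  also have "\<dots> = (P *\<^sub>v (E *\<^sub>v x)) \<bullet>c y"
    using c E xy by (intro cscalar_prod_adjoint[symmetric]) auto
  also have "P *\<^sub>v (E *\<^sub>v x) = P *\<^sub>v (E *\<^sub>v (P *\<^sub>v x))" by (simp add: fixed[OF x])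
  also have "\<dots> = (P * E * P) *\<^sub>v x"
    using c E xy by (simp add: assoc_mult_mat_vec[of _ N N _ N])
  also have "\<dots> = z \<cdot>\<^sub>v x"
    using c xy by (simp add: PEP smult_mat_mult_vec[of P N N] fixed[OF x])
  finally show ?thesis using xy by simp
qed

text \<open>With the basis vectors as columns, \<open>V\<close> is an isometry onto
  \<open>Q\<close>, and \<open>V * mat_adjoint V\<close> is the projector. This supplies existence
  for \<open>orth_projector\<close>.\<close>

lemma orthonormal_basis_gram:
  assumes "orthonormal_basis N Q vs"
  defines "V \<equiv> mat_of_cols N vs"
  shows "V \<in> carrier_mat N (length vs)" "mat_adjoint V * V = 1\<^sub>m (length vs)"
    and "is_orth_projector N Q (V * mat_adjoint V)"
proof -
  show V: "V \<in> carrier_mat N (length vs)" by (simp add: V_def)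
  note V' = mat_adjoint_carrier[OF V]
  have vs: "set vs \<subseteq> carrier_vec N" using assms by (simp add: orthonormal_basis_def)
  have cols: "cols V = vs" using vs by (simp add: V_def)
  have vsc: "vs ! i \<in> carrier_vec N" if "i < length vs" for i using vs that by auto
  show gram: "mat_adjoint V * V = 1\<^sub>m (length vs)"
  proof (rule eq_matI)
    fix i j assume "i < dim_row (1\<^sub>m (length vs) :: complex mat)" "j < dim_col (1\<^sub>m (length vs) :: complex mat)"
    then have ij: "i < length vs" "j < length vs" by auto
    have "(mat_adjoint V * V) $$ (i, j) = vs ! j \<bullet>c vs ! i"
      using ij V vsc[OF ij(1)] vsc[OF ij(2)]
      by (auto simp: scalar_prod_def mat_adjoint_dim mat_adjoint_index V_def mat_of_cols_index
          mult.commute intro!: sum.cong)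
    then show "(mat_adjoint V * V) $$ (i, j) = 1\<^sub>m (length vs) $$ (i, j)"
      using assms ij by (auto simp: orthonormal_basis_def)
  qed (use V V' in auto)
  \<comment> \<open>Opens the locale in which the span of the columns is \<open>col_space V\<close>,
    and hence the image of \<open>V\<close>.\<close>
  interpret vec_space "TYPE(complex)" N .
  have "Q = col_space V"
    using assms cols by (simp add: orthonormal_basis_def col_space_def)
  then have Q: "Q = {y \<in> carrier_vec N. \<exists>x\<in>carrier_vec (length vs). V *\<^sub>v x = y}"
    using col_space_eq[OF V] V by auto
  have P: "V * mat_adjoint V \<in> carrier_mat N N" using V V' by auto
  have PV: "V * mat_adjoint V * V = V"
    using V V' gram by (simp add: assoc_mult_mat[OF V V' V])
  have idem: "(V * mat_adjoint V) * (V * mat_adjoint V) = V * mat_adjoint V"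
    using assoc_mult_mat[OF P V V'] PV by simp
  have "(\<lambda>x. (V * mat_adjoint V) *\<^sub>v x) ` carrier_vec N = Q"
  proof (intro equalityI subsetI)
    fix y assume "y \<in> (\<lambda>x. (V * mat_adjoint V) *\<^sub>v x) ` carrier_vec N"
    then obtain x where x: "x \<in> carrier_vec N" "y = V *\<^sub>v (mat_adjoint V *\<^sub>v x)"
      using V V' by (auto simp: assoc_mult_mat_vec[OF V V'])
    moreover have "mat_adjoint V *\<^sub>v x \<in> carrier_vec (length vs)"
      using V' x(1) by (rule mult_mat_vec_carrier)
    ultimately show "y \<in> Q" unfolding Q using V by auto
  next
    fix y assume "y \<in> Q"
    then obtain x where x: "x \<in> carrier_vec (length vs)" "y = V *\<^sub>v x" "y \<in> carrier_vec N"
      unfolding Q by auto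
    have "(V * mat_adjoint V) *\<^sub>v y = y"
      using assoc_mult_mat_vec[OF P V x(1)] by (simp add: x(2) PV)
    then show "y \<in> (\<lambda>x. (V * mat_adjoint V) *\<^sub>v x) ` carrier_vec N"
      using x(3) by (metis imageI)
  qed
  moreover have "mat_adjoint (V * mat_adjoint V) = V * mat_adjoint V"
    by (simp add: mat_adjoint_mult[OF V V'] mat_adjoint_adjoint)
  ultimately show "is_orth_projector N Q (V * mat_adjoint V)"
    using P idem by (simp add: is_orth_projector_def)
qed

lemma is_orth_projector_orth_projector:
  "orthonormal_basis N Q vs \<Longrightarrow> is_orth_projector N Q (orth_projector N Q)"
  using orthonormal_basis_gram(3) orth_projector_eq by metis

text \<open>Detectability says that \<open>mat_adjoint V * E * V\<close> is a scalar matrix;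
  conjugating by \<open>V\<close> gives the compression. The result no longer mentions the basis,
  which matters because the basis witnessing detectability may differ from the one given by the word
  operators.\<close>

lemma detectable_compression:
  assumes "detectable N Q E" and E: "E \<in> carrier_mat N N"
  obtains z where "orth_projector N Q * E * orth_projector N Q = z \<cdot>\<^sub>m orth_projector N Q"
proof -
  obtain vs where vs: "orthonormal_basis N Q vs"
    and diag: "\<And>i j. i < length vs \<Longrightarrow> j < length vs \<Longrightarrow>
      (E *\<^sub>v vs ! i) \<bullet>c vs ! i = (E *\<^sub>v vs ! j) \<bullet>c vs ! j"
    and off: "\<And>i j. i < length vs \<Longrightarrow> j < length vs \<Longrightarrow> i \<noteq> j \<Longrightarrow> (E *\<^sub>v vs ! j) \<bullet>c vs ! i = 0"
    using assms(1) unfolding detectable_def by blast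
  define V where "V = mat_of_cols N vs"
  \<comment> \<open>For an empty basis \<open>vs ! 0\<close> is unspecified, which is harmless: the
    matrices compared below then have no entries.\<close>
  define z where "z = (E *\<^sub>v vs ! 0) \<bullet>c vs ! 0"
  note V = orthonormal_basis_gram(1)[OF vs, folded V_def]
  note V' = mat_adjoint_carrier[OF V]
  note P = orth_projector_eq[OF orthonormal_basis_gram(3)[OF vs], folded V_def]
  have vsc: "vs ! i \<in> carrier_vec N" if "i < length vs" for i
    using vs that by (auto simp: orthonormal_basis_def)
  have EV: "E * V \<in> carrier_mat N (length vs)" using E V by auto
  have "mat_adjoint V * (E * V) = z \<cdot>\<^sub>m 1\<^sub>m (length vs)"
  proof (rule eq_matI)
    fix i j assume "i < dim_row (z \<cdot>\<^sub>m 1\<^sub>m (length vs))" "j < dim_col (z \<cdot>\<^sub>m 1\<^sub>m (length vs))"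
    then have ij: "i < length vs" "j < length vs" by auto
    then have len: "0 < length vs" by linarith
    have colj: "col V j = vs ! j" using ij vsc[OF ij(2)] by (simp add: V_def)
    have "(mat_adjoint V * (E * V)) $$ (i, j) = (\<Sum>k<N. cnj (V $$ (k, i)) * (E * V) $$ (k, j))"
      using ij V E by (auto simp: scalar_prod_def[of "row (mat_adjoint V) i"] mat_adjoint_dim mat_adjoint_index lessThan_atLeast0)
    also have "\<dots> = (\<Sum>k<N. (E *\<^sub>v vs ! j) $ k * cnj (vs ! i $ k))"
      using ij E V colj by (intro sum.cong refl) (auto simp: V_def mat_of_cols_index)
    also have "\<dots> = (E *\<^sub>v vs ! j) \<bullet>c vs ! i"
      using E vsc[OF ij(1)] by (auto simp: scalar_prod_def lessThan_atLeast0)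
    also have "\<dots> = (if i = j then z else 0)"
      using diag[OF ij(2) len] off[OF ij] by (auto simp: z_def)
    finally show "(mat_adjoint V * (E * V)) $$ (i, j) = (z \<cdot>\<^sub>m 1\<^sub>m (length vs)) $$ (i, j)"
      using ij by simp
  qed (use V EV in \<open>auto simp: mat_adjoint_dim\<close>)
  then have mid: "mat_adjoint V * E * V = z \<cdot>\<^sub>m 1\<^sub>m (length vs)"
    by (simp add: assoc_mult_mat[OF V' E V])
  have V'E: "mat_adjoint V * E \<in> carrier_mat (length vs) N" using V' E by (rule mult_carrier_mat)
  have VV': "V * mat_adjoint V \<in> carrier_mat N N" using V V' by (rule mult_carrier_mat)
  have V'EV: "mat_adjoint V * E * V \<in> carrier_mat (length vs) (length vs)"
    using V'E V by (rule mult_carrier_mat)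
  have "(V * mat_adjoint V) * E * (V * mat_adjoint V) = V * (mat_adjoint V * E * V) * mat_adjoint V"
    by (simp only: assoc_mult_mat[OF V V' E] assoc_mult_mat[OF V V'E VV']
        assoc_mult_mat[OF V'E V V', symmetric] assoc_mult_mat[OF V V'EV V'])
  also have "\<dots> = z \<cdot>\<^sub>m (V * mat_adjoint V)"
    by (simp add: mid mult_smult_distrib[OF V one_carrier_mat] right_mult_one_mat[OF V]
        mult_smult_assoc_mat[OF V V'])
  finally show ?thesis using that P by simp
qed

section \<open>Codeword-stabilized codes\<close>

text \<open>Assuming a scalar compression, rather than detectability, lets the lemma serve twice:
  for operators of small weight, and for showing that a nontrivial word operator lies outside the
  levels \<open>1\<close> and \<open>-1\<close>.\<close>

lemma word_operator_compression:
  fixes n c :: nat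
  defines "N \<equiv> 2 ^ (n + c)" and "J \<equiv> (1\<^sub>m (2 ^ c) :: complex mat)"
  assumes basis: "orthonormal_basis N Q (map (\<lambda>\<omega>. (\<omega> \<otimes>\<^sub>k J) *\<^sub>v v) ws)"
    and ws: "distinct ws" "set ws \<subseteq> pauli_P n" "1\<^sub>m (2 ^ n) \<in> set ws" "\<omega> \<in> set ws"
    and v: "v \<in> carrier_vec N"
    and s: "s \<in> pauli_P n" "(s \<otimes>\<^sub>k J) *\<^sub>v v = v"
    and \<alpha>: "\<alpha> \<in> pauli_E n" "\<omega> * s = \<i> ^ k \<cdot>\<^sub>m \<alpha>"
    and PEP: "orth_projector N Q * (\<alpha> \<otimes>\<^sub>k J) * orth_projector N Q = z \<cdot>\<^sub>m orth_projector N Q"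
  shows "\<omega> = 1\<^sub>m (2 ^ n) \<and> (z = 1 \<or> z = - 1)"
proof -
  define b where "b = (\<lambda>\<omega>. (\<omega> \<otimes>\<^sub>k J) *\<^sub>v v)"
  define E where "E = \<alpha> \<otimes>\<^sub>k J"
  have N: "2 ^ n * 2 ^ c = N" by (simp add: N_def power_add)
  have J: "J \<in> carrier_mat (2 ^ c) (2 ^ c)" by (simp add: J_def)
  have kc: "A \<otimes>\<^sub>k J \<in> carrier_mat N N" if "A \<in> carrier_mat (2 ^ n) (2 ^ n)" for A
    using kron_carrier[OF that J] by (simp add: N)
  have km: "((A * B) \<otimes>\<^sub>k J) *\<^sub>v v = (A \<otimes>\<^sub>k J) *\<^sub>v ((B \<otimes>\<^sub>k J) *\<^sub>v v)"
    if "A \<in> carrier_mat (2 ^ n) (2 ^ n)" "B \<in> carrier_mat (2 ^ n) (2 ^ n)" for A B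
    using kron_mult[OF that(1) J that(2) J] assoc_mult_mat_vec[OF kc[OF that(1)] kc[OF that(2)] v]
    by (simp add: J_def)
  have \<alpha>c: "\<alpha> \<in> carrier_mat (2 ^ n) (2 ^ n)" and sc: "s \<in> carrier_mat (2 ^ n) (2 ^ n)"
    and \<omega>c: "\<omega> \<in> carrier_mat (2 ^ n) (2 ^ n)"
    using \<alpha>(1) s(1) ws by (auto dest: pauli_E_carrier pauli_P_carrier)
  note Ec = kc[OF \<alpha>c, folded E_def]
  have b1: "b (1\<^sub>m (2 ^ n)) = v" using v by (simp add: b_def J_def kron_one N)
  have inQ: "b \<tau> \<in> Q" if "\<tau> \<in> set ws" for \<tau>
  proof -
    interpret vec_space "TYPE(complex)" N .
    have "set (map b ws) \<subseteq> carrier_vec N" "span (set (map b ws)) = Q"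
      using basis by (auto simp: orthonormal_basis_def b_def)
    then show ?thesis using that in_own_span[of "set (map b ws)"] by auto
  qed
  \<comment> \<open>Distinctness of \<open>ws\<close> turns equality of positions into equality of
    operators.\<close>
  have orth: "b \<tau> \<bullet>c b \<rho> = (if \<tau> = \<rho> then 1 else 0)" if "\<tau> \<in> set ws" "\<rho> \<in> set ws" for \<tau> \<rho>
  proof -
    obtain i where i: "i < length ws" "ws ! i = \<rho>" using \<open>\<rho> \<in> set ws\<close> unfolding in_set_conv_nth by blast
    obtain j where j: "j < length ws" "ws ! j = \<tau>" using \<open>\<tau> \<in> set ws\<close> unfolding in_set_conv_nth by blast
    note ij = i j
    have "map b ws ! j \<bullet>c map b ws ! i = (if i = j then 1 else 0)"
      using basis ij by (auto simp: orthonormal_basis_def b_def)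
    then show ?thesis using ij ws(1) by (auto simp: nth_eq_iff_index_eq)
  qed
  \<comment> \<open>Since \<open>s\<close> fixes \<open>v\<close>, the operators
    \<open>\<omega>\<close> and \<open>\<omega> * s\<close> have the same effect on it.\<close>
  have b\<omega>: "b \<omega> = \<i> ^ k \<cdot>\<^sub>v (E *\<^sub>v v)"
  proof -
    have "b \<omega> = ((\<omega> * s) \<otimes>\<^sub>k J) *\<^sub>v v" using km[OF \<omega>c sc] by (simp add: b_def s)
    then show ?thesis
      using smult_mat_mult_vec[OF Ec v] by (simp add: \<alpha> smult_kron_left E_def)
  qed
  have vQ: "v \<in> Q" using inQ[OF ws(3)] b1 by simp
  have Ev: "E *\<^sub>v v \<in> carrier_vec N" using Ec v by auto
  have b\<omega>c: "b \<omega> \<in> carrier_vec N" using Ev by (simp add: b\<omega>)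
  \<comment> \<open>Only the first of the two copies of \<open>b \<omega>\<close> in its squared
    norm is rewritten, which produces a matrix element of \<open>E\<close> between two basis
    vectors.\<close>
  have "1 = \<i> ^ k * ((E *\<^sub>v v) \<bullet>c b \<omega>)"
    using orth[OF ws(4) ws(4)] Ev b\<omega>c by (subst (asm) (1) b\<omega>) simp
  also have "(E *\<^sub>v v) \<bullet>c b \<omega> = z * (v \<bullet>c b \<omega>)"
    using compression_cscalar_prod[OF is_orth_projector_orth_projector[OF basis] Ec _ vQ inQ[OF ws(4)]]
      PEP by (simp add: E_def)
  also have "v \<bullet>c b \<omega> = (if 1\<^sub>m (2 ^ n) = \<omega> then 1 else 0)"
    using orth[OF ws(3,4)] b1 by simp
  finally have one: "\<omega> = 1\<^sub>m (2 ^ n)" "1 = \<i> ^ k * z" by (auto split: if_splits)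
  have v_eq: "v = \<i> ^ k \<cdot>\<^sub>v (E *\<^sub>v v)" using b\<omega> b1 one by simp
  have "E *\<^sub>v (E *\<^sub>v v) = v"
    using km[OF \<alpha>c \<alpha>c] b1 by (simp add: pauli_E_square[OF \<alpha>(1)] E_def b_def)
  \<comment> \<open>Applying \<open>E\<close> to \<open>v_eq\<close> and using that \<open>E\<close>
    is an involution on \<open>v\<close>; substituting back shows that the phase squares to one, and
    then so does \<open>z\<close>.\<close>
  then have "E *\<^sub>v v = \<i> ^ k \<cdot>\<^sub>v v"
    using arg_cong[OF v_eq, of "\<lambda>x. E *\<^sub>v x"] mult_mat_vec[OF Ec Ev] by simp
  then have "v = (\<i> ^ k * \<i> ^ k) \<cdot>\<^sub>v v" using v_eq by (simp add: smult_smult_assoc)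
  then have "v \<bullet>c v = (\<i> ^ k * \<i> ^ k) * (v \<bullet>c v)"
    using v by (metis carrier_vec_conjugate smult_scalar_prod_distrib)
  then have "\<i> ^ k * \<i> ^ k = 1" using orth[OF ws(3,3)] b1 by simp
  moreover have "(\<i> ^ k * \<i> ^ k) * (z * z) = 1"
    using one(2) by (metis mult.assoc mult.left_commute mult_1)
  ultimately have "z * z = 1" by simp
  then show ?thesis using one(1) by (simp add: square_eq_1_iff)
qed

theorem lemma23:
  fixes n M d c :: nat
    and Q :: "complex vec set"
    and S W :: "complex mat set"
  assumes "EA_CWS_code n M d c Q S W"
  shows "d \<le> Min (pauli_wt n `
    (phase_free n ` set_prod W (isotropic n c S) - phase_free n ` GS_group n c Q))"
proof -
  define N where "N = (2 :: nat) ^ (n + c)"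
  define J where "J = (1\<^sub>m (2 ^ c) :: complex mat)"
  obtain v ws where vws: "stabilizer_state (n + c) S v" "set ws = W" "distinct ws"
    and basis: "orthonormal_basis N Q (map (\<lambda>\<omega>. (\<omega> \<otimes>\<^sub>k J) *\<^sub>v v) ws)"
    and code: "EA_code n M d c Q" and cws: "CWS_group (n + c) S"
    and W: "W \<subseteq> pauli_P n" "1\<^sub>m (2 ^ n) \<in> W"
    using assms by (auto simp: EA_CWS_code_def N_def J_def)
  have v: "v \<in> carrier_vec N" "\<And>a. a \<in> S \<Longrightarrow> a *\<^sub>v v = v"
    using vws(1) by (auto simp: stabilizer_state_def N_def)
  let ?A = "phase_free n ` set_prod W (isotropic n c S)"
  let ?B = "phase_free n ` GS_group n c Q"
  \<comment> \<open>The scalar \<open>z\<close> is quantified inside, since it comes from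
    detectability in one use and is \<open>1\<close> or \<open>-1\<close> by membership in a level
    set in the other.\<close>
  have product: "phase_free n (\<omega> * s) \<in> pauli_E n \<and>
      (\<forall>z. orth_projector N Q * (phase_free n (\<omega> * s) \<otimes>\<^sub>k J) * orth_projector N Q = z \<cdot>\<^sub>m orth_projector N Q \<longrightarrow>
        \<omega> = 1\<^sub>m (2 ^ n) \<and> (z = 1 \<or> z = - 1))"
    if \<omega>: "\<omega> \<in> W" and s: "s \<in> isotropic n c S" for \<omega> s
  proof -
    have sP: "s \<in> pauli_P n" "(s \<otimes>\<^sub>k J) *\<^sub>v v = v"
      using s v(2) by (auto simp: isotropic_def J_def)
    obtain k \<alpha> where \<alpha>: "k \<in> {0, 1, 2, 3}" "\<alpha> \<in> pauli_E n" "\<omega> * s = \<i> ^ k \<cdot>\<^sub>m \<alpha>"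
      using pauli_P_mult[of \<omega> n s] \<omega> W(1) sP(1) by (blast elim: pauli_P_E)
    have "phase_free n (\<omega> * s) = \<alpha>" using phase_free_eq[OF \<alpha>(2,1)] \<alpha>(3) by simp
    moreover have "\<omega> = 1\<^sub>m (2 ^ n) \<and> (z = 1 \<or> z = - 1)"
      if "orth_projector N Q * (\<alpha> \<otimes>\<^sub>k J) * orth_projector N Q = z \<cdot>\<^sub>m orth_projector N Q" for z
      using word_operator_compression[OF basis[unfolded N_def J_def] vws(3) _ _ _ _ sP(1) _ \<alpha>(2,3)]
        W vws(2) \<omega> v(1) sP(2) that unfolding N_def J_def by blast
    ultimately show ?thesis using \<alpha>(2) by simp
  qed
  have sub: "?A \<subseteq> pauli_E n" using product by (auto simp: set_prod_def)
  have level: "\<alpha> \<in> S_level n c Q j \<longleftrightarrow> \<alpha> \<in> pauli_E n \<and>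
      orth_projector N Q * (\<alpha> \<otimes>\<^sub>k J) * orth_projector N Q = complex_of_real j \<cdot>\<^sub>m orth_projector N Q" for \<alpha> j
    by (simp add: S_level_def Let_def N_def J_def)
  have "d \<le> pauli_wt n \<alpha>" if \<alpha>: "\<alpha> \<in> ?A - ?B" for \<alpha>
  proof (rule ccontr)
    assume "\<not> d \<le> pauli_wt n \<alpha>"
    moreover have E: "\<alpha> \<in> pauli_E n" using \<alpha> sub by blast
    ultimately have "detectable N Q (\<alpha> \<otimes>\<^sub>k J)"
      using code by (auto simp: EA_code_def N_def J_def)
    moreover have "\<alpha> \<otimes>\<^sub>k J \<in> carrier_mat N N"
      using kron_carrier[OF pauli_E_carrier[OF E], of J "2 ^ c" "2 ^ c"]
      by (simp add: J_def N_def power_add)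
    ultimately obtain z where
      z: "orth_projector N Q * (\<alpha> \<otimes>\<^sub>k J) * orth_projector N Q = z \<cdot>\<^sub>m orth_projector N Q"
      by (rule detectable_compression)
    then have "z = 1 \<or> z = - 1" using \<alpha> product by (auto simp: set_prod_def)
    then have "\<alpha> \<in> S_level n c Q 1 \<or> \<alpha> \<in> S_level n c Q (-1)" using z E level by auto
    then show False using \<alpha> by (auto simp: phase_free_GS_group)
  qed
  moreover have "finite (?A - ?B)" using finite_subset[OF sub finite_pauli_E] by simp
  \<comment> \<open>\<open>Min\<close> is unspecified on the empty set, so the bound also needs an
    element to minimise over; one comes from a word operator other than the identity.\<close>
  moreover have "?A - ?B \<noteq> {}"
  proof -
    \<comment> \<open>A one-dimensional space detects everything, contradicting the undetectable operator of weight \<open>d\<close>.\<close>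
    have "\<exists>\<omega>\<in>W. \<omega> \<noteq> 1\<^sub>m (2 ^ n)"
    proof (rule ccontr)
      assume "\<not> ?thesis"
      then have "W = {1\<^sub>m (2 ^ n)}" using W(2) by blast
      then have "length ws = 1" using vws(2) distinct_card[OF vws(3)] by simp
      then have "detectable N Q E" for E
        unfolding detectable_def using basis by (intro exI[of _ "map (\<lambda>\<omega>. (\<omega> \<otimes>\<^sub>k J) *\<^sub>v v) ws"]) simp
      then show False using code by (auto simp: EA_code_def N_def)
    qed
    then obtain \<omega> where \<omega>: "\<omega> \<in> W" "\<omega> \<noteq> 1\<^sub>m (2 ^ n)" by blast
    \<comment> \<open>The identity is isotropic, so word operators themselves occur among the
      products.\<close>
    have "1\<^sub>m (2 ^ (n + c)) \<in> S"
      using cws subgroup.one_closed[of S "pauli_group (n + c)"]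
      by (simp add: CWS_group_def stabilizer_group_def pauli_group_def)
    then have I: "1\<^sub>m (2 ^ n) \<in> isotropic n c S"
      using W by (auto simp: isotropic_def kron_one power_add)
    let ?\<alpha> = "phase_free n (\<omega> * 1\<^sub>m (2 ^ n))"
    have "?\<alpha> \<in> ?A" using \<omega>(1) I by (auto simp: set_prod_def)
    moreover have "?\<alpha> \<notin> ?B"
      \<comment> \<open>Membership in \<open>?B\<close> would give a scalar compression and so force
        \<open>\<omega>\<close> to be the identity.\<close>
      using product[OF \<omega>(1) I] \<omega>(2) by (auto simp: phase_free_GS_group level)
    ultimately show ?thesis by blast
  qed
  ultimately show ?thesis by (subst Min_ge_iff) auto
qed

end
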